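(* In the realizability model $\mathcal{N}$, with $\mathcal{D}[\alpha]$ the formula expressing that the relation $\langle y<x\rangle\ge\alpha$ is well founded, the following are realized: (i) $\forall\alpha^{\beth2}\forall\beta^{\beth2}\big(\alpha\wedge\beta=0\hookrightarrow(\mathcal{D}[\alpha\vee\beta]\to\mathcal{D}[\alpha]\vee\mathcal{D}[\beta])\big)$; (ii) $\forall\alpha^{\beth2}\forall\beta^{\beth2}\big(\mathcal{D}[\alpha\vee\beta]\to\mathcal{D}[\alpha]\vee\mathcal{D}[\beta]\big)$.
   Context: Classical realizability (Krivine): ground model $\mathcal{M}$ of ZF + V = L with a realizability algebra $(\Lambda,\Pi,\Lambda\star\Pi,\mathrm{QP},\perp\!\!\!\perp)$; $\mathcal{N}$ has the same individuals as $\mathcal{M}$; formulas of ZF$_\varepsilon$ (atomic $a\not\varepsilon b$, $a\notin b$, $a\subset b$, $\bot$; $\to,\forall$; function symbols defined in $\mathcal{M}$) get truth values $\|F\|\subseteq\Pi$ with $\|a\not\varepsilon b\|=\{\pi:(a,\pi)\in b\}$, $\|F\to G\|=\{\xi\cdot\pi:\xi\Vdash F,\pi\in\|G\|\}$, $\|\forall xF\|=\bigcup_a\|F[a]\|$, and $\xi\Vdash F$ iff $\xi\star\pi\in\perp\!\!\!\perp$ for all $\pi\in\|F\|$; "realized" means realized by a proof-like term. $\|R\hookrightarrow F\|=\|F\|$ if the $\mathcal{M}$-relation $R$ holds, $\emptyset$ otherwise. $\beth2=\{0,1\}\times\Pi$, with Boolean operations $\wedge,\vee,\neg$ and order $\le$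 extended from $\{0,1\}$; $\forall\alpha^{\beth2}$ is the quantifier with $\|\forall\alpha^{\beth2}F\|=\bigcup_{\alpha\in\{0,1\}}\|F[\alpha]\|$. $\langle y<x\rangle\in\{0,1\}$ is the characteristic function of $y\in\mathrm{Cl}(x)$ in $\mathcal{M}$. $\mathcal{D}[\alpha]\equiv\forall X(\forall x(\forall y(\langle y<x\rangle\ge\alpha\hookrightarrow y\not\varepsilon X)\to x\not\varepsilon X)\to\forall x(x\not\varepsilon X))$. *)

theory Defs
  imports Main
begin

text \<open>
  A structure for the language of set theory is a type \<open>'m\<close> of individuals with a binary
  relation \<open>E\<close>; it need be neither well founded nor transitive.  The set \<open>ext E a\<close> consists of
  the elements of \<open>a\<close> in the sense of the structure.  In the definitions below HOL sets of
  individuals only serve as a notation for classes given by first-order conditions over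
  \<open>(UNIV, E)\<close>.
\<close>

datatype setfm = Mem nat nat | Eq nat nat | Neg setfm | Conj setfm setfm | Exists nat setfm

primrec sats :: "('m \<Rightarrow> 'm \<Rightarrow> bool) \<Rightarrow> (nat \<Rightarrow> 'm) \<Rightarrow> setfm \<Rightarrow> bool" where
  "sats E e (Mem i j) \<longleftrightarrow> E (e i) (e j)"
| "sats E e (Eq i j) \<longleftrightarrow> e i = e j"
| "sats E e (Neg p) \<longleftrightarrow> \<not> sats E e p"
| "sats E e (Conj p q) \<longleftrightarrow> sats E e p \<and> sats E e q"
| "sats E e (Exists i p) \<longleftrightarrow> (\<exists>a. sats E (e(i := a)) p)"

definition ext :: "('m \<Rightarrow> 'm \<Rightarrow> bool) \<Rightarrow> 'm \<Rightarrow> 'm set" where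
  "ext E a = {x. E x a}"

definition ZF_model :: "('m \<Rightarrow> 'm \<Rightarrow> bool) \<Rightarrow> bool" where
  "ZF_model E \<longleftrightarrow>
     (\<forall>a b. ext E a = ext E b \<longrightarrow> a = b) \<and>
     (\<forall>a. ext E a \<noteq> {} \<longrightarrow> (\<exists>x\<in>ext E a. ext E x \<inter> ext E a = {})) \<and>
     (\<forall>a b. \<exists>c. ext E c = {a, b}) \<and>
     (\<forall>a. \<exists>u. ext E u = (\<Union>x\<in>ext E a. ext E x)) \<and>
     (\<forall>a. \<exists>p. ext E p = {x. ext E x \<subseteq> ext E a}) \<and>
     (\<exists>w. (\<exists>z\<in>ext E w. ext E z = {}) \<and>
          (\<forall>x\<in>ext E w. \<exists>y\<in>ext E w. ext E y = insert x (ext E x))) \<and>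
     \<comment> \<open>in the schemes the assignment \<open>e\<close> supplies the parameters\<close>
     (\<forall>p e a. \<exists>b. ext E b = {x \<in> ext E a. sats E (e(0 := x)) p}) \<and>
     (\<forall>p e a. (\<forall>x\<in>ext E a. \<exists>!y. sats E (e(0 := x, 1 := y)) p) \<longrightarrow>
        (\<exists>b. ext E b = {y. \<exists>x\<in>ext E a. sats E (e(0 := x, 1 := y)) p}))"

definition zero :: "('m \<Rightarrow> 'm \<Rightarrow> bool) \<Rightarrow> 'm" where
  "zero E = (THE c. ext E c = {})"

definition upair :: "('m \<Rightarrow> 'm \<Rightarrow> bool) \<Rightarrow> 'm \<Rightarrow> 'm \<Rightarrow> 'm" where
  "upair E a b = (THE c. ext E c = {a, b})"

definition one :: "('m \<Rightarrow> 'm \<Rightarrow> bool) \<Rightarrow> 'm" where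
  "one E = upair E (zero E) (zero E)"

definition opair :: "('m \<Rightarrow> 'm \<Rightarrow> bool) \<Rightarrow> 'm \<Rightarrow> 'm \<Rightarrow> 'm" where
  "opair E a b = upair E (upair E a a) (upair E a b)"

definition opairs :: "('m \<Rightarrow> 'm \<Rightarrow> bool) \<Rightarrow> 'm set \<Rightarrow> 'm set \<Rightarrow> 'm set" where
  "opairs E A B = {opair E a b | a b. a \<in> A \<and> b \<in> B}"

definition is_fun :: "('m \<Rightarrow> 'm \<Rightarrow> bool) \<Rightarrow> 'm \<Rightarrow> 'm set \<Rightarrow> 'm set \<Rightarrow> bool" where
  "is_fun E f A B \<longleftrightarrow> ext E f \<subseteq> opairs E A B \<and> (\<forall>x\<in>A. \<exists>!y. opair E x y \<in> ext E f)"

definition val :: "('m \<Rightarrow> 'm \<Rightarrow> bool) \<Rightarrow> 'm \<Rightarrow> 'm \<Rightarrow> 'm" where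
  "val E f x = (THE y. opair E x y \<in> ext E f)"

definition transitive :: "('m \<Rightarrow> 'm \<Rightarrow> bool) \<Rightarrow> 'm \<Rightarrow> bool" where
  "transitive E a \<longleftrightarrow> (\<forall>x\<in>ext E a. ext E x \<subseteq> ext E a)"

text \<open>In the presence of foundation, the ordinals are the transitive sets of transitive sets.\<close>

definition ordinal :: "('m \<Rightarrow> 'm \<Rightarrow> bool) \<Rightarrow> 'm \<Rightarrow> bool" where
  "ordinal E a \<longleftrightarrow> transitive E a \<and> (\<forall>x\<in>ext E a. transitive E x)"

definition successor_closed :: "('m \<Rightarrow> 'm \<Rightarrow> bool) \<Rightarrow> 'm \<Rightarrow> bool" where
  "successor_closed E w \<longleftrightarrow> (\<exists>z\<in>ext E w. ext E z = {}) \<and>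
     (\<forall>x\<in>ext E w. \<exists>y\<in>ext E w. ext E y = insert x (ext E x))"

definition omega :: "('m \<Rightarrow> 'm \<Rightarrow> bool) \<Rightarrow> 'm" where
  "omega E = (THE w. successor_closed E w \<and> (\<forall>v. successor_closed E v \<longrightarrow> ext E w \<subseteq> ext E v))"

text \<open>The transitive closure of \<open>x\<close>: the least transitive set that includes \<open>x\<close> (as a subset, so
  that \<open>x\<close> is not a member of it).\<close>

definition Cl :: "('m \<Rightarrow> 'm \<Rightarrow> bool) \<Rightarrow> 'm \<Rightarrow> 'm" where
  "Cl E x = (THE c. transitive E c \<and> ext E x \<subseteq> ext E c \<and>
     (\<forall>d. transitive E d \<and> ext E x \<subseteq> ext E d \<longrightarrow> ext E c \<subseteq> ext E d))"

text \<open>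
  Definability over \<open>A\<close> has to be expressed inside the structure, whose natural numbers may be
  nonstandard.  A formula over \<open>A\<close> is represented by the set of \<open>\<omega>\<close>-sequences of elements of \<open>A\<close>
  that satisfy it.  These sets form the least family containing the atomic ones and closed under
  complement, intersection and existential quantification of the \<open>i\<close>-th variable.
\<close>

definition seqs :: "('m \<Rightarrow> 'm \<Rightarrow> bool) \<Rightarrow> 'm \<Rightarrow> 'm set" where
  "seqs E A = {s. is_fun E s (ext E (omega E)) (ext E A)}"

definition agree_off :: "('m \<Rightarrow> 'm \<Rightarrow> bool) \<Rightarrow> 'm \<Rightarrow> 'm \<Rightarrow> 'm \<Rightarrow> bool" where
  "agree_off E i s t \<longleftrightarrow> (\<forall>j\<in>ext E (omega E). j \<noteq> i \<longrightarrow> val E s j = val E t j)"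

definition closed_family :: "('m \<Rightarrow> 'm \<Rightarrow> bool) \<Rightarrow> 'm \<Rightarrow> 'm \<Rightarrow> bool" where
  "closed_family E A F \<longleftrightarrow>
     (\<forall>i\<in>ext E (omega E). \<forall>j\<in>ext E (omega E).
        (\<exists>r\<in>ext E F. ext E r = {s \<in> seqs E A. E (val E s i) (val E s j)}) \<and>
        (\<exists>r\<in>ext E F. ext E r = {s \<in> seqs E A. val E s i = val E s j})) \<and>
     (\<forall>r\<in>ext E F. \<exists>r'\<in>ext E F. ext E r' = seqs E A - ext E r) \<and>
     (\<forall>r\<in>ext E F. \<forall>q\<in>ext E F. \<exists>r'\<in>ext E F. ext E r' = ext E r \<inter> ext E q) \<and>
     (\<forall>i\<in>ext E (omega E). \<forall>r\<in>ext E F. \<exists>r'\<in>ext E F.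
        ext E r' = {s \<in> seqs E A. \<exists>t\<in>ext E r \<inter> seqs E A. agree_off E i s t})"

text \<open>
  \<open>X \<in> Def(A)\<close>: some formula, with the values of \<open>s\<close> as parameters and the variable \<open>0\<close> for the
  element, defines \<open>X\<close> over \<open>A\<close>.  The empty set is listed separately because there are no
  sequences over the empty set \<open>A\<close>.
\<close>

definition in_Def :: "('m \<Rightarrow> 'm \<Rightarrow> bool) \<Rightarrow> 'm \<Rightarrow> 'm \<Rightarrow> bool" where
  "in_Def E A X \<longleftrightarrow> ext E X = {} \<or>
     (\<exists>r. (\<forall>F. closed_family E A F \<longrightarrow> r \<in> ext E F) \<and>
        (\<exists>s\<in>seqs E A. ext E X = {val E t (zero E) | t. t \<in> ext E r \<inter> seqs E A \<and> agree_off E (zero E) s t}))"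

text \<open>
  \<open>g\<close> is the sequence of the \<open>L\<^sub>\<beta>\<close> for \<open>\<beta> < d\<close>, where \<open>L\<^sub>\<beta>\<close> is the union of the
  \<open>Def(L\<^sub>\<gamma>)\<close> for \<open>\<gamma> < \<beta>\<close>; this covers zero, successor and limit stages uniformly.
\<close>

definition L_sequence :: "('m \<Rightarrow> 'm \<Rightarrow> bool) \<Rightarrow> 'm \<Rightarrow> 'm \<Rightarrow> bool" where
  "L_sequence E d g \<longleftrightarrow> ordinal E d \<and> is_fun E g (ext E d) UNIV \<and>
     (\<forall>b\<in>ext E d. ext E (val E g b) = {X. \<exists>c\<in>ext E b. in_Def E (val E g c) X})"

definition V_eq_L :: "('m \<Rightarrow> 'm \<Rightarrow> bool) \<Rightarrow> bool" where
  "V_eq_L E \<longleftrightarrow> (\<forall>x. \<exists>d g. L_sequence E d g \<and> (\<exists>b\<in>ext E d. x \<in> ext E (val E g b)))"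

text \<open>
  All components are sets of the ground model; the operations (application, push, formation of
  processes and \<open>\<pi> \<mapsto> k\<^sub>\<pi>\<close>) are functions in the sense of the ground model.
  The final conditions are the execution rules of the machine, e.g. \<open>K \<star> s \<cdot> t \<cdot> p \<succ> s \<star> p\<close>, in the form
  of closure of the pole under anti-reduction.
\<close>

record 'm ralg =
  Terms :: 'm
  Stacks :: 'm
  Procs :: 'm
  QP :: 'm
  Pole :: 'm
  AppF :: 'm
  PushF :: 'm
  ProcF :: 'm
  ContF :: 'm
  cB :: 'm
  cC :: 'm
  cI :: 'm
  cK :: 'm
  cW :: 'm
  cCC :: 'm

definition app :: "('m \<Rightarrow> 'm \<Rightarrow> bool) \<Rightarrow> 'm ralg \<Rightarrow> 'm \<Rightarrow> 'm \<Rightarrow> 'm" where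
  "app E A s t = val E (AppF A) (opair E s t)"

definition push :: "('m \<Rightarrow> 'm \<Rightarrow> bool) \<Rightarrow> 'm ralg \<Rightarrow> 'm \<Rightarrow> 'm \<Rightarrow> 'm" where
  "push E A s p = val E (PushF A) (opair E s p)"

definition proc :: "('m \<Rightarrow> 'm \<Rightarrow> bool) \<Rightarrow> 'm ralg \<Rightarrow> 'm \<Rightarrow> 'm \<Rightarrow> 'm" where
  "proc E A s p = val E (ProcF A) (opair E s p)"

definition cont :: "('m \<Rightarrow> 'm \<Rightarrow> bool) \<Rightarrow> 'm ralg \<Rightarrow> 'm \<Rightarrow> 'm" where
  "cont E A p = val E (ContF A) p"

definition in_pole :: "('m \<Rightarrow> 'm \<Rightarrow> bool) \<Rightarrow> 'm ralg \<Rightarrow> 'm \<Rightarrow> 'm \<Rightarrow> bool" where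
  "in_pole E A s p \<longleftrightarrow> proc E A s p \<in> ext E (Pole A)"

definition realizability_algebra :: "('m \<Rightarrow> 'm \<Rightarrow> bool) \<Rightarrow> 'm ralg \<Rightarrow> bool" where
  "realizability_algebra E A \<longleftrightarrow>
     (let \<Lambda> = ext E (Terms A); \<Pi> = ext E (Stacks A) in
      is_fun E (AppF A) (opairs E \<Lambda> \<Lambda>) \<Lambda> \<and>
      is_fun E (PushF A) (opairs E \<Lambda> \<Pi>) \<Pi> \<and>
      is_fun E (ProcF A) (opairs E \<Lambda> \<Pi>) (ext E (Procs A)) \<and>
      is_fun E (ContF A) \<Pi> \<Lambda> \<and>
      ext E (QP A) \<subseteq> \<Lambda> \<and>
      {cB A, cC A, cI A, cK A, cW A, cCC A} \<subseteq> ext E (QP A) \<and>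
      (\<forall>s\<in>ext E (QP A). \<forall>t\<in>ext E (QP A). app E A s t \<in> ext E (QP A)) \<and>
      ext E (Pole A) \<subseteq> ext E (Procs A) \<and>
      (\<forall>s\<in>\<Lambda>. \<forall>t\<in>\<Lambda>. \<forall>u\<in>\<Lambda>. \<forall>p\<in>\<Pi>. \<forall>q\<in>\<Pi>.
         (in_pole E A s (push E A t p) \<longrightarrow> in_pole E A (app E A s t) p) \<and>
         (in_pole E A s (push E A (app E A t u) p) \<longrightarrow>
            in_pole E A (cB A) (push E A s (push E A t (push E A u p)))) \<and>
         (in_pole E A s (push E A u (push E A t p)) \<longrightarrow>
            in_pole E A (cC A) (push E A s (push E A t (push E A u p)))) \<and>
         (in_pole E A s p \<longrightarrow> in_pole E A (cI A) (push E A s p)) \<and>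
         (in_pole E A s p \<longrightarrow> in_pole E A (cK A) (push E A s (push E A t p))) \<and>
         (in_pole E A s (push E A t (push E A t p)) \<longrightarrow>
            in_pole E A (cW A) (push E A s (push E A t p))) \<and>
         (in_pole E A s (push E A (cont E A p) p) \<longrightarrow> in_pole E A (cCC A) (push E A s p)) \<and>
         (in_pole E A s p \<longrightarrow> in_pole E A (cont E A p) (push E A s q))))"

text \<open>
  Closed ZF\<open>\<epsilon>\<close> formulas with parameters in the ground model, without the extensional atoms
  \<open>a \<notin> b\<close> and \<open>a \<subset> b\<close>: they are built from the atomic formulas \<open>a \<notin>\<^sub>\<epsilon> b\<close> (the strong, non-extensional membership) and \<open>\<bottom>\<close>.  A quantified formula is given by
  the family of its instances.  \<open>\<forall>\<^bold>2\<close> is the quantifier restricted to \<open>\<beth>2\<close>, and \<open>R \<hookrightarrow> F\<close> is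
  the guarded formula for a relation \<open>R\<close> of the ground model.
\<close>

datatype 'm zfe =
    NotEps 'm 'm  (infix "\<notin>\<^sub>\<epsilon>" 60)
  | Falsum  ("\<^bold>\<bottom>")
  | Imp "'m zfe" "'m zfe"  (infixr "\<^bold>\<rightarrow>" 55)
  | Guard bool "'m zfe"  (infixr "\<hookrightarrow>" 55)
  | Forall "'m \<Rightarrow> 'm zfe"  (binder "\<^bold>\<forall>" 10)
  | ForallB2 "'m \<Rightarrow> 'm zfe"  (binder "\<forall>\<^bold>2" 10)

definition Not_zfe :: "'m zfe \<Rightarrow> 'm zfe"  ("\<^bold>\<not> _" [57] 57) where
  "\<^bold>\<not> F = (F \<^bold>\<rightarrow> \<^bold>\<bottom>)"

definition Or_zfe :: "'m zfe \<Rightarrow> 'm zfe \<Rightarrow> 'm zfe"  (infixr "\<^bold>\<or>" 56) where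
  "F \<^bold>\<or> G = (\<^bold>\<not> F \<^bold>\<rightarrow> \<^bold>\<not> G \<^bold>\<rightarrow> \<^bold>\<bottom>)"

primrec falsity :: "('m \<Rightarrow> 'm \<Rightarrow> bool) \<Rightarrow> 'm ralg \<Rightarrow> 'm zfe \<Rightarrow> 'm set" where
  "falsity E A (a \<notin>\<^sub>\<epsilon> b) = {p \<in> ext E (Stacks A). opair E a p \<in> ext E b}"
| "falsity E A \<^bold>\<bottom> = ext E (Stacks A)"
| "falsity E A (F \<^bold>\<rightarrow> G) =
     {push E A s p | s p. s \<in> ext E (Terms A) \<and> (\<forall>q\<in>falsity E A F. in_pole E A s q) \<and>
        p \<in> falsity E A G}"
| "falsity E A (R \<hookrightarrow> F) = (if R then falsity E A F else {})"
| "falsity E A (Forall F) = (\<Union>a. falsity E A (F a))"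
| "falsity E A (ForallB2 F) = (\<Union>a\<in>{zero E, one E}. falsity E A (F a))"

definition forces :: "('m \<Rightarrow> 'm \<Rightarrow> bool) \<Rightarrow> 'm ralg \<Rightarrow> 'm \<Rightarrow> 'm zfe \<Rightarrow> bool" where
  "forces E A s F \<longleftrightarrow> s \<in> ext E (Terms A) \<and> (\<forall>p\<in>falsity E A F. in_pole E A s p)"

definition realized :: "('m \<Rightarrow> 'm \<Rightarrow> bool) \<Rightarrow> 'm ralg \<Rightarrow> 'm zfe \<Rightarrow> bool" where
  "realized E A F \<longleftrightarrow> (\<exists>s\<in>ext E (QP A). forces E A s F)"

text \<open>The operations are only meant for arguments in \<open>{0, 1}\<close>.\<close>

definition bmeet :: "('m \<Rightarrow> 'm \<Rightarrow> bool) \<Rightarrow> 'm \<Rightarrow> 'm \<Rightarrow> 'm" where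
  "bmeet E a b = (if a = one E \<and> b = one E then one E else zero E)"

definition bjoin :: "('m \<Rightarrow> 'm \<Rightarrow> bool) \<Rightarrow> 'm \<Rightarrow> 'm \<Rightarrow> 'm" where
  "bjoin E a b = (if a = one E \<or> b = one E then one E else zero E)"

definition ble :: "('m \<Rightarrow> 'm \<Rightarrow> bool) \<Rightarrow> 'm \<Rightarrow> 'm \<Rightarrow> bool" where
  "ble E a b \<longleftrightarrow> a = zero E \<or> b = one E"

definition below :: "('m \<Rightarrow> 'm \<Rightarrow> bool) \<Rightarrow> 'm \<Rightarrow> 'm \<Rightarrow> 'm" where
  "below E y x = (if y \<in> ext E (Cl E x) then one E else zero E)"

definition WF :: "('m \<Rightarrow> 'm \<Rightarrow> bool) \<Rightarrow> 'm \<Rightarrow> 'm zfe" where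
  "WF E \<alpha> =
     (\<^bold>\<forall>X. (\<^bold>\<forall>x. (\<^bold>\<forall>y. ble E \<alpha> (below E y x) \<hookrightarrow> y \<notin>\<^sub>\<epsilon> X) \<^bold>\<rightarrow> x \<notin>\<^sub>\<epsilon> X) \<^bold>\<rightarrow> (\<^bold>\<forall>x. x \<notin>\<^sub>\<epsilon> X))"

end

theory Submission
  imports Defs
begin

text \<open>
  Suppose that \<open>X\<close> has no minimal element for \<open>\<langle>y < x\<rangle> \<ge> \<alpha>\<close> and \<open>Y\<close> none for
  \<open>\<langle>y < x\<rangle> \<ge> \<beta>\<close>.  Let \<open>Z\<close> be the set of all \<open>m x x'\<close> with \<open>x \<epsilon> X\<close> and \<open>x' \<epsilon> Y\<close>, where the
  ground model function \<open>m\<close> is the first projection if \<open>\<alpha> = 1\<close> and the second one otherwise.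
  For \<open>\<alpha>, \<beta> \<in> {0, 1}\<close> the conditions \<open>\<langle>y < x\<rangle> \<ge> \<alpha>\<close> and \<open>\<langle>y' < x'\<rangle> \<ge> \<beta>\<close> imply
  \<open>\<langle>m y y' < m x x'\<rangle> \<ge> \<alpha> \<or> \<beta>\<close>, so \<open>Z\<close> has no minimal element for the relation of the
  disjunction.  The realizer extracted from this argument does not depend on \<open>\<alpha>\<close> and \<open>\<beta>\<close>.
  The falsity value of \<open>m x x' \<notin>\<^sub>\<epsilon> Z\<close> consists
  of the stacks \<open>k\<^sub>\<rho> \<cdot> \<pi>\<close> with \<open>(x, \<rho>) \<in> X\<close> and \<open>(x', \<pi>) \<in> Y\<close>: the continuations \<open>k\<^sub>\<rho>\<close> take
  the place of arbitrary realizers of \<open>x \<epsilon> X\<close>, which could come from a proper class of \<open>x\<close>.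
\<close>

subsection \<open>Pairs and functions in the ground model\<close>

locale ground_model =
  fixes E :: "'m \<Rightarrow> 'm \<Rightarrow> bool"
  assumes ZF: "ZF_model E"
begin

lemma
  shows extensionality: "ext E a = ext E b \<Longrightarrow> a = b"
    and pair_ex: "\<exists>c. ext E c = {a, b}"
    and union_ex: "\<exists>u. ext E u = (\<Union>x\<in>ext E a. ext E x)"
    and power_ex: "\<exists>p. ext E p = {x. ext E x \<subseteq> ext E a}"
    and separation: "\<exists>b. ext E b = {x \<in> ext E a. sats E (e(0 := x)) p}"
proof -
  have "\<forall>a b. ext E a = ext E b \<longrightarrow> a = b" "\<forall>a b. \<exists>c. ext E c = {a, b}"
    "\<forall>a. \<exists>u. ext E u = (\<Union>x\<in>ext E a. ext E x)" "\<forall>a. \<exists>p. ext E p = {x. ext E x \<subseteq> ext E a}"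
    "\<forall>p e a. \<exists>b. ext E b = {x \<in> ext E a. sats E (e(0 := x)) p}"
    by (insert ZF[unfolded ZF_model_def], (elim conjE, assumption)+)
  then show "ext E a = ext E b \<Longrightarrow> a = b" "\<exists>c. ext E c = {a, b}"
    "\<exists>u. ext E u = (\<Union>x\<in>ext E a. ext E x)" "\<exists>p. ext E p = {x. ext E x \<subseteq> ext E a}"
    "\<exists>b. ext E b = {x \<in> ext E a. sats E (e(0 := x)) p}"
    by simp_all
qed

lemma ext_upair: "ext E (upair E a b) = {a, b}"
proof -
  obtain c where "ext E c = {a, b}"
    using pair_ex by blast
  then have "\<exists>!c. ext E c = {a, b}"
    using extensionality by auto
  then show ?thesis
    unfolding upair_def by (rule theI')
qed

lemma eq_upair_iff: "c = upair E a b \<longleftrightarrow> E a c \<and> E b c \<and> (\<forall>x. E x c \<longrightarrow> x = a \<or> x = b)"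
proof
  assume "c = upair E a b"
  then show "E a c \<and> E b c \<and> (\<forall>x. E x c \<longrightarrow> x = a \<or> x = b)"
    using ext_upair[of a b] by (auto simp: ext_def)
next
  assume "E a c \<and> E b c \<and> (\<forall>x. E x c \<longrightarrow> x = a \<or> x = b)"
  then have "ext E c = ext E (upair E a b)"
    unfolding ext_upair by (auto simp: ext_def)
  then show "c = upair E a b"
    by (rule extensionality)
qed

lemma upair_eq_iff: "upair E a b = upair E c d \<longleftrightarrow> {a, b} = {c, d}"
  using ext_upair extensionality by metis

lemma opair_eq_iff [simp]: "opair E a b = opair E c d \<longleftrightarrow> a = c \<and> b = d"
  unfolding opair_def upair_eq_iff by (auto simp: doubleton_eq_iff upair_eq_iff)

lemma val_eq_iff:
  assumes "is_fun E f D R" and "x \<in> D"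
  shows "opair E x y \<in> ext E f \<longleftrightarrow> y = val E f x"
proof -
  have ex1: "\<exists>!y. opair E x y \<in> ext E f"
    using assms unfolding is_fun_def by blast
  then have "opair E x (val E f x) \<in> ext E f"
    unfolding val_def by (rule theI')
  with ex1 show ?thesis by blast
qed

lemma val_in:
  assumes "is_fun E f D R" and "x \<in> D"
  shows "val E f x \<in> R"
proof -
  have "opair E x (val E f x) \<in> ext E f"
    using val_eq_iff[OF assms] by simp
  then show ?thesis
    using assms(1) unfolding is_fun_def opairs_def by fastforce
qed

subsection \<open>Separation for sets of pairs\<close>

text \<open>The variables \<open>99, \<dots>, 102\<close> are reserved for the bound variables of these formulas.\<close>

definition upair_fm :: "nat \<Rightarrow> nat \<Rightarrow> nat \<Rightarrow> setfm" where
  "upair_fm c a b = Conj (Mem a c) (Conj (Mem b c)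
     (Neg (Exists 100 (Conj (Mem 100 c) (Conj (Neg (Eq 100 a)) (Neg (Eq 100 b)))))))"

definition opair_fm :: "nat \<Rightarrow> nat \<Rightarrow> nat \<Rightarrow> setfm" where
  "opair_fm c a b = Exists 101 (Exists 102
     (Conj (upair_fm 101 a a) (Conj (upair_fm 102 a b) (upair_fm c 101 102))))"

definition opair_mem_fm :: "nat \<Rightarrow> nat \<Rightarrow> nat \<Rightarrow> setfm" where
  "opair_mem_fm a b c = Exists 99 (Conj (opair_fm 99 a b) (Mem 99 c))"

lemma sats_upair_fm:
  "\<lbrakk>a \<noteq> 100; b \<noteq> 100; c \<noteq> 100\<rbrakk> \<Longrightarrow> sats E e (upair_fm c a b) \<longleftrightarrow> e c = upair E (e a) (e b)"
  by (auto simp: upair_fm_def eq_upair_iff)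

lemma sats_opair_fm:
  "\<lbrakk>a < 100; b < 100; c < 100\<rbrakk> \<Longrightarrow> sats E e (opair_fm c a b) \<longleftrightarrow> e c = opair E (e a) (e b)"
  by (simp add: opair_fm_def sats_upair_fm opair_def)

lemma sats_opair_mem_fm:
  "\<lbrakk>a < 99; b < 99; c < 99\<rbrakk> \<Longrightarrow>
     sats E e (opair_mem_fm a b c) \<longleftrightarrow> opair E (e a) (e b) \<in> ext E (e c)"
  by (simp add: opair_mem_fm_def sats_opair_fm ext_def)

lemma binary_union_ex: "\<exists>u. ext E u = ext E a \<union> ext E b"
  using union_ex[of "upair E a b"] by (simp add: ext_upair)

text \<open>A Kuratowski pair is a set of subsets of the union, so two power sets suffice. An upper
  bound is enough, as separation cuts it down.\<close>

lemma product_superset_ex: "\<exists>p. \<forall>x\<in>ext E a. \<forall>y\<in>ext E b. opair E x y \<in> ext E p"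
proof -
  obtain u where u: "ext E u = ext E a \<union> ext E b"
    using binary_union_ex by blast
  obtain p where p: "ext E p = {x. ext E x \<subseteq> ext E u}"
    using power_ex by blast
  obtain q where q: "ext E q = {x. ext E x \<subseteq> ext E p}"
    using power_ex by blast
  show ?thesis
    by (rule exI[of _ q]) (auto simp: q p u opair_def ext_upair)
qed

text \<open>Two unions undo the Kuratowski coding: \<open>x\<close> lies in
  \<open>upair E x x\<close>, which lies in the pair.\<close>

lemma domain_superset_ex: "\<exists>d. \<forall>x y. opair E x y \<in> ext E r \<longrightarrow> x \<in> ext E d"
proof -
  obtain u where u: "ext E u = (\<Union>x\<in>ext E r. ext E x)"
    using union_ex by blast
  obtain d where d: "ext E d = (\<Union>x\<in>ext E u. ext E x)"
    using union_ex by blast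
  show ?thesis
  proof (intro exI[of _ d] allI impI)
    fix x y assume "opair E x y \<in> ext E r"
    then have "upair E x x \<in> ext E u"
      using u by (force simp: opair_def ext_upair)
    then show "x \<in> ext E d"
      using d by (force simp: ext_upair)
  qed
qed

end

subsection \<open>Execution\<close>

locale krivine_model = ground_model E for E :: "'m \<Rightarrow> 'm \<Rightarrow> bool" +
  fixes A :: "'m ralg"
  assumes algebra: "realizability_algebra E A"
begin

abbreviation terms :: "'m set" where "terms \<equiv> ext E (Terms A)"
abbreviation stacks :: "'m set" where "stacks \<equiv> ext E (Stacks A)"
abbreviation ap :: "'m \<Rightarrow> 'm \<Rightarrow> 'm"  (infixl "\<cdot>" 75) where "s \<cdot> t \<equiv> app E A s t"
abbreviation cons_stack :: "'m \<Rightarrow> 'm \<Rightarrow> 'm"  (infixr "\<triangleright>" 70) where "s \<triangleright> p \<equiv> push E A s p"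
abbreviation pole :: "'m \<Rightarrow> 'm \<Rightarrow> bool"  (infix "\<star>" 60) where "s \<star> p \<equiv> in_pole E A s p"
abbreviation k :: "'m \<Rightarrow> 'm" where "k p \<equiv> cont E A p"
abbreviation B :: 'm where "B \<equiv> cB A"
abbreviation C :: 'm where "C \<equiv> cC A"
abbreviation cc :: 'm where "cc \<equiv> cCC A"

lemma operations_fun:
  "is_fun E (AppF A) (opairs E terms terms) terms"
  "is_fun E (PushF A) (opairs E terms stacks) stacks"
  "is_fun E (ContF A) stacks terms"
  using algebra unfolding realizability_algebra_def Let_def by blast+

lemma app_closed: "\<lbrakk>s \<in> terms; t \<in> terms\<rbrakk> \<Longrightarrow> s \<cdot> t \<in> terms"
  unfolding app_def by (rule val_in[OF operations_fun(1)]) (auto simp: opairs_def)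

lemma push_closed: "\<lbrakk>s \<in> terms; p \<in> stacks\<rbrakk> \<Longrightarrow> s \<triangleright> p \<in> stacks"
  unfolding push_def by (rule val_in[OF operations_fun(2)]) (auto simp: opairs_def)

lemma cont_closed: "p \<in> stacks \<Longrightarrow> k p \<in> terms"
  unfolding cont_def by (rule val_in[OF operations_fun(3)])

text \<open>Lets the separation formula for the merged set refer to the operation through its graph,
  a parameter.\<close>

lemma push_graph_iff:
  "\<lbrakk>s \<in> terms; p \<in> stacks\<rbrakk> \<Longrightarrow> opair E (opair E s p) q \<in> ext E (PushF A) \<longleftrightarrow> q = s \<triangleright> p"
  unfolding push_def by (rule val_eq_iff[OF operations_fun(2)]) (auto simp: opairs_def)

lemma cont_graph_iff: "p \<in> stacks \<Longrightarrow> opair E p s \<in> ext E (ContF A) \<longleftrightarrow> s = k p"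
  unfolding cont_def by (rule val_eq_iff[OF operations_fun(3)])

lemma QP_terms: "s \<in> ext E (QP A) \<Longrightarrow> s \<in> terms"
  using algebra unfolding realizability_algebra_def Let_def by blast

lemma QP_closed:
  "B \<in> ext E (QP A)" "C \<in> ext E (QP A)" "cc \<in> ext E (QP A)"
  "\<lbrakk>s \<in> ext E (QP A); t \<in> ext E (QP A)\<rbrakk> \<Longrightarrow> s \<cdot> t \<in> ext E (QP A)"
  using algebra unfolding realizability_algebra_def Let_def by blast+

lemmas closed = QP_closed(1-3)[THEN QP_terms] app_closed push_closed cont_closed

lemma execution:
  assumes "s \<in> terms" "p \<in> stacks"
  shows run_app: "\<lbrakk>t \<in> terms; s \<star> t \<triangleright> p\<rbrakk> \<Longrightarrow> s \<cdot> t \<star> p"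
    and run_B: "\<lbrakk>t \<in> terms; u \<in> terms; s \<star> (t \<cdot> u) \<triangleright> p\<rbrakk> \<Longrightarrow> B \<star> s \<triangleright> t \<triangleright> u \<triangleright> p"
    and run_C: "\<lbrakk>t \<in> terms; u \<in> terms; s \<star> u \<triangleright> t \<triangleright> p\<rbrakk> \<Longrightarrow> C \<star> s \<triangleright> t \<triangleright> u \<triangleright> p"
    and run_cc: "s \<star> k p \<triangleright> p \<Longrightarrow> cc \<star> s \<triangleright> p"
    and run_cont: "\<lbrakk>q \<in> stacks; s \<star> p\<rbrakk> \<Longrightarrow> k p \<star> s \<triangleright> q"
  using algebra assms unfolding realizability_algebra_def Let_def by blast+

text \<open>
  As \<open>\<lambda>\<close>-terms, the combinators below are
  \<open>contrapos = \<lambda>h \<kappa>'. cc (\<lambda>\<kappa>. \<kappa>' (h \<kappa>))\<close>, \<open>postcomp = \<lambda>r v h. v \<circ> r h\<close>,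
  \<open>descent = \<lambda>u v h. v \<circ> contrapos (u \<circ> contrapos h)\<close> and
  \<open>splitter = \<lambda>\<xi> a b. a (\<lambda>u. cc (\<lambda>\<kappa>. b (\<lambda>v. \<xi> (descent u v) \<kappa>)))\<close>.
\<close>

definition contrapos :: 'm where
  "contrapos = B \<cdot> (B \<cdot> cc) \<cdot> (C \<cdot> B)"

definition postcomp :: 'm where
  "postcomp = C \<cdot> (B \<cdot> B \<cdot> B)"

definition descent :: 'm where
  "descent = B \<cdot> postcomp \<cdot> (B \<cdot> (B \<cdot> contrapos) \<cdot> (postcomp \<cdot> contrapos))"

definition split_body :: 'm where
  "split_body = B \<cdot> (B \<cdot> C) \<cdot> (postcomp \<cdot> descent)"

definition split_left :: 'm where
  "split_left = B \<cdot> (B \<cdot> (B \<cdot> cc)) \<cdot> (B \<cdot> postcomp \<cdot> split_body)"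

definition splitter :: 'm where
  "splitter = B \<cdot> (C \<cdot> B) \<cdot> split_left"

lemma combinators_QP:
  "contrapos \<in> ext E (QP A)" "postcomp \<in> ext E (QP A)" "descent \<in> ext E (QP A)"
  "split_body \<in> ext E (QP A)" "split_left \<in> ext E (QP A)" "splitter \<in> ext E (QP A)"
  unfolding contrapos_def postcomp_def descent_def split_body_def split_left_def splitter_def
  by (intro QP_closed)+

lemmas terms_closed = closed combinators_QP[THEN QP_terms]

text \<open>\<open>cc\<close> saves \<open>q\<close> as \<open>k q\<close>, then \<open>k p\<close>
  restores \<open>p\<close>: the two stacks change places.\<close>

lemma run_contrapos:
  assumes "h \<in> terms" "p \<in> stacks" "q \<in> stacks" "h \<star> k q \<triangleright> p"
  shows "contrapos \<star> h \<triangleright> k p \<triangleright> q"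
  unfolding contrapos_def by (rule execution terms_closed assms)+

lemma run_postcomp:
  assumes "r \<in> terms" "v \<in> terms" "h \<in> terms" "x \<in> terms" "p \<in> stacks"
    and "v \<star> (r \<cdot> h \<cdot> x) \<triangleright> p"
  shows "postcomp \<star> r \<triangleright> v \<triangleright> h \<triangleright> x \<triangleright> p"
  unfolding postcomp_def by (rule execution terms_closed assms)+

text \<open>\<open>P\<close> and \<open>Q\<close> stand for the falsity values of the premises of
  progressiveness in the two sets. For each \<open>q'\<close> in \<open>Q\<close>,
  \<open>contrapos \<cdot> h \<cdot> k q'\<close> passes every test in \<open>P\<close>, so
  \<open>u\<close> accepts it; swapping stacks again gives a term that passes every test in
  \<open>Q\<close>, so \<open>v\<close> accepts it.\<close>

lemma run_descent:
  assumes "u \<in> terms" "v \<in> terms" "h \<in> terms" "p \<in> stacks" "q \<in> stacks"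
    and "P \<subseteq> stacks" "Q \<subseteq> stacks"
    and u: "\<And>t. \<lbrakk>t \<in> terms; \<forall>p'\<in>P. t \<star> p'\<rbrakk> \<Longrightarrow> u \<star> t \<triangleright> p"
    and v: "\<And>t. \<lbrakk>t \<in> terms; \<forall>q'\<in>Q. t \<star> q'\<rbrakk> \<Longrightarrow> v \<star> t \<triangleright> q"
    and h: "\<And>p' q'. \<lbrakk>p' \<in> P; q' \<in> Q\<rbrakk> \<Longrightarrow> h \<star> k p' \<triangleright> q'"
  shows "descent \<star> u \<triangleright> v \<triangleright> h \<triangleright> k p \<triangleright> q"
proof -
  let ?r = "B \<cdot> (B \<cdot> contrapos) \<cdot> (postcomp \<cdot> contrapos)"
  \<comment> \<open>As a \<lambda>-term, this is
    \<open>contrapos (u \<circ> contrapos h) (k p)\<close>.\<close>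
  have "?r \<cdot> u \<cdot> h \<cdot> k p \<star> q'" if "q' \<in> Q" for q'
  proof -
    have q': "q' \<in> stacks"
      using that assms(7) by blast
    have "contrapos \<cdot> h \<cdot> k q' \<star> p'" if "p' \<in> P" for p'
    proof -
      have "p' \<in> stacks"
        using that assms(6) by blast
      then show ?thesis
        using h[OF \<open>p' \<in> P\<close> \<open>q' \<in> Q\<close>] q' assms(3)
        by (intro execution run_contrapos terms_closed)
    qed
    then have "u \<star> (contrapos \<cdot> h \<cdot> k q') \<triangleright> p"
      by (intro u terms_closed ballI assms(3) q')
    then show ?thesis
      by - (rule execution run_contrapos run_postcomp terms_closed assms(1-5) q' | assumption)+
  qed
  then have "v \<star> (?r \<cdot> u \<cdot> h \<cdot> k p) \<triangleright> q"
    by (intro v terms_closed ballI assms(1-5))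
  then show ?thesis
    unfolding descent_def
    by - (rule execution run_postcomp terms_closed assms(1-5) | assumption)+
qed

lemma run_split_body:
  assumes "f \<in> terms" "u \<in> terms" "x \<in> terms" "v \<in> terms" "p \<in> stacks"
    and "f \<star> (descent \<cdot> u \<cdot> v) \<triangleright> x \<triangleright> p"
  shows "split_body \<star> f \<triangleright> u \<triangleright> x \<triangleright> v \<triangleright> p"
  unfolding split_body_def by (rule execution run_postcomp terms_closed assms)+

lemma run_split_left:
  assumes "f \<in> terms" "b \<in> terms" "u \<in> terms" "p \<in> stacks"
    and "b \<star> (split_body \<cdot> f \<cdot> u \<cdot> k p) \<triangleright> p"
  shows "split_left \<star> f \<triangleright> b \<triangleright> u \<triangleright> p"
  unfolding split_left_def by (rule execution run_postcomp terms_closed assms)+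

lemma run_splitter:
  assumes "f \<in> terms" "a \<in> terms" "b \<in> terms" "p \<in> stacks"
    and "a \<star> (split_left \<cdot> f \<cdot> b) \<triangleright> p"
  shows "splitter \<star> f \<triangleright> a \<triangleright> b \<triangleright> p"
  unfolding splitter_def by (rule execution terms_closed assms)+

subsection \<open>Well-foundedness\<close>

definition progressive :: "'m \<Rightarrow> 'm \<Rightarrow> 'm zfe" where
  "progressive \<alpha> X = (\<^bold>\<forall>x. (\<^bold>\<forall>y. ble E \<alpha> (below E y x) \<hookrightarrow> y \<notin>\<^sub>\<epsilon> X) \<^bold>\<rightarrow> x \<notin>\<^sub>\<epsilon> X)"

lemma forces_Imp_iff:
  "forces E A s (F \<^bold>\<rightarrow> G) \<longleftrightarrow>
     s \<in> terms \<and> (\<forall>t p. forces E A t F \<longrightarrow> p \<in> falsity E A G \<longrightarrow> s \<star> t \<triangleright> p)"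
  by (auto simp: forces_def)

lemma forces_ForallB2_iff:
  "forces E A s (ForallB2 F) \<longleftrightarrow> (\<forall>\<alpha>\<in>{zero E, one E}. forces E A s (F \<alpha>))"
  by (auto simp: forces_def)

text \<open>A guard keeps the falsity value or empties it; hence one term serves for both statements
  of the theorem.\<close>

lemma forces_Guard: "forces E A s F \<Longrightarrow> forces E A s (R \<hookrightarrow> F)"
  by (simp add: forces_def)

text \<open>The range of \<open>q\<close> is the falsity value of the premise, in the form needed
  for \<open>P\<close> and \<open>Q\<close> in \<open>run_descent\<close>.\<close>

lemma forces_progressive_iff:
  "forces E A u (progressive \<alpha> X) \<longleftrightarrow> u \<in> terms \<and>
     (\<forall>x t p. t \<in> terms \<longrightarrow>
        (\<forall>q\<in>{q \<in> stacks. \<exists>y. ble E \<alpha> (below E y x) \<and> opair E y q \<in> ext E X}. t \<star> q) \<longrightarrow>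
        p \<in> stacks \<longrightarrow> opair E x p \<in> ext E X \<longrightarrow> u \<star> t \<triangleright> p)"
  by (fastforce simp: progressive_def forces_def split: if_splits)

lemma forces_WF_iff:
  "forces E A s (WF E \<alpha>) \<longleftrightarrow> s \<in> terms \<and>
     (\<forall>X u x p. forces E A u (progressive \<alpha> X) \<longrightarrow> p \<in> stacks \<longrightarrow> opair E x p \<in> ext E X \<longrightarrow>
        s \<star> u \<triangleright> p)"
  unfolding WF_def progressive_def[symmetric] by (fastforce simp: forces_def)

text \<open>Only pairs whose second component is a stack affect falsity values, so \<open>Z\<close>
  is left free elsewhere. \<open>left\<close> will be \<open>\<alpha> = one E\<close>.\<close>

definition merges :: "bool \<Rightarrow> 'm \<Rightarrow> 'm \<Rightarrow> 'm \<Rightarrow> bool" where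
  "merges left X Y Z \<longleftrightarrow> (\<forall>z. \<forall>r\<in>stacks. opair E z r \<in> ext E Z \<longleftrightarrow>
     (\<exists>x y p q. z = (if left then x else y) \<and> r = k p \<triangleright> q \<and> p \<in> stacks \<and> q \<in> stacks \<and>
        opair E x p \<in> ext E X \<and> opair E y q \<in> ext E Y))"

lemma mergesD:
  assumes "merges left X Y Z" "r \<in> stacks" "opair E z r \<in> ext E Z"
  obtains x y p q where "z = (if left then x else y)" "r = k p \<triangleright> q" "p \<in> stacks" "q \<in> stacks"
    "opair E x p \<in> ext E X" "opair E y q \<in> ext E Y"
  using assms unfolding merges_def by blast

lemma mergesI:
  assumes "merges left X Y Z" "p \<in> stacks" "q \<in> stacks"
    "opair E x p \<in> ext E X" "opair E y q \<in> ext E Y"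
  shows "opair E (if left then x else y) (k p \<triangleright> q) \<in> ext E Z"
proof -
  have "k p \<triangleright> q \<in> stacks"
    by (intro closed assms)
  then show ?thesis
    using assms unfolding merges_def by blast
qed

lemma merges_ex: "\<exists>Z. merges left X Y Z"
proof -
  \<comment> \<open>the variables \<open>6, \<dots>, 12\<close> stand for \<open>x\<close>, \<open>y\<close>, \<open>p\<close>, \<open>q\<close>, \<open>k p\<close>,
    the pair \<open>(k p, q)\<close> and the stack \<open>k p \<triangleright> q\<close>\<close>
  let ?e = "(\<lambda>_. X)(2 := Y, 3 := Stacks A, 4 := ContF A, 5 := PushF A)"
  let ?fm = "Exists 6 (Exists 7 (Exists 8 (Exists 9 (Exists 10 (Exists 11 (Exists 12
    (Conj (opair_fm 0 (if left then 6 else 7) 12) (Conj (Mem 8 3) (Conj (Mem 9 3)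
    (Conj (opair_mem_fm 6 8 1) (Conj (opair_mem_fm 7 9 2)
    (Conj (opair_mem_fm 8 10 4) (Conj (opair_fm 11 10 9) (opair_mem_fm 11 12 5))))))))))))))"
  \<comment> \<open>The first components of \<open>Z\<close> come from just one of the two sets, so
    \<open>D\<close> bounds them; \<open>S\<close> then contains all pairs to be separated.\<close>
  obtain D where D: "\<And>x p. opair E x p \<in> ext E (if left then X else Y) \<Longrightarrow> x \<in> ext E D"
    using domain_superset_ex by blast
  obtain S where S: "\<And>x p. \<lbrakk>x \<in> ext E D; p \<in> stacks\<rbrakk> \<Longrightarrow> opair E x p \<in> ext E S"
    using product_superset_ex by blast
  obtain Z where Z: "ext E Z = {w \<in> ext E S. sats E (?e(0 := w)) ?fm}"
    using separation by blast
  have fm: "sats E (?e(0 := w)) ?fm \<longleftrightarrow>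
    (\<exists>x y p q. w = opair E (if left then x else y) (k p \<triangleright> q) \<and> p \<in> stacks \<and> q \<in> stacks \<and>
        opair E x p \<in> ext E X \<and> opair E y q \<in> ext E Y)" for w
  proof -
    have "E p (Stacks A) \<longleftrightarrow> p \<in> stacks" for p
      by (simp add: ext_def)
    then show ?thesis
      by (simp add: sats_opair_fm sats_opair_mem_fm cont_graph_iff push_graph_iff cont_closed
          cong: conj_cong)
  qed
  show ?thesis
    unfolding merges_def using D S
    by (intro exI[of _ Z] allI ballI)
      (fastforce simp only: Z[unfolded fm] mem_Collect_eq opair_eq_iff split: if_splits)
qed

text \<open>If \<alpha> is 1, so is the join, and the first comparison is the one required;
  otherwise the join is \<beta> and the second one is.\<close>

lemma below_merge:
  assumes "\<alpha> \<in> {zero E, one E}" "\<beta> \<in> {zero E, one E}"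
    and "ble E \<alpha> (below E y x)" "ble E \<beta> (below E y' x')"
  shows "ble E (bjoin E \<alpha> \<beta>)
    (below E (if \<alpha> = one E then y else y') (if \<alpha> = one E then x else x'))"
  using assms by (auto simp: bjoin_def ble_def)

lemma descent_progressive:
  assumes "\<alpha> \<in> {zero E, one E}" "\<beta> \<in> {zero E, one E}"
    and Z: "merges (\<alpha> = one E) X Y Z"
    and u: "forces E A u (progressive \<alpha> X)" and v: "forces E A v (progressive \<beta> Y)"
  shows "forces E A (descent \<cdot> u \<cdot> v) (progressive (bjoin E \<alpha> \<beta>) Z)"
proof -
  have uv: "u \<in> terms" "v \<in> terms"
    using u v by (auto simp: forces_def)
  have "descent \<cdot> u \<cdot> v \<star> h \<triangleright> r"
    if h: "h \<in> terms" "\<forall>q\<in>{q \<in> stacks. \<exists>y. ble E (bjoin E \<alpha> \<beta>) (below E y z) \<and>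
        opair E y q \<in> ext E Z}. h \<star> q"
      and r: "r \<in> stacks" "opair E z r \<in> ext E Z" for z h r
  proof -
    \<comment> \<open>\<open>z\<close> shows only one of \<open>x\<close> and \<open>y\<close>, but
      the stack \<open>k p \<triangleright> q\<close> keeps evidence for both.\<close>
    obtain x y p q where pq: "z = (if \<alpha> = one E then x else y)" "r = k p \<triangleright> q"
        "p \<in> stacks" "q \<in> stacks" "opair E x p \<in> ext E X" "opair E y q \<in> ext E Y"
      using mergesD[OF Z r] by blast
    let ?P = "{p' \<in> stacks. \<exists>x'. ble E \<alpha> (below E x' x) \<and> opair E x' p' \<in> ext E X}"
    let ?Q = "{q' \<in> stacks. \<exists>y'. ble E \<beta> (below E y' y) \<and> opair E y' q' \<in> ext E Y}"
    have "h \<star> k p' \<triangleright> q'" if pq': "p' \<in> ?P" "q' \<in> ?Q" for p' q'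
    proof -
      obtain x' y' where "ble E \<alpha> (below E x' x)" "opair E x' p' \<in> ext E X"
          "ble E \<beta> (below E y' y)" "opair E y' q' \<in> ext E Y"
        using pq' by blast
      \<comment> \<open>Both coordinates descend together, so the merged point precedes
        \<open>z\<close> and \<open>h\<close> has to handle its stack.\<close>
      then have "opair E (if \<alpha> = one E then x' else y') (k p' \<triangleright> q') \<in> ext E Z"
        "ble E (bjoin E \<alpha> \<beta>) (below E (if \<alpha> = one E then x' else y') z)"
        using pq' pq(1) by (auto intro!: mergesI[OF Z] below_merge[OF assms(1,2)]
            simp del: if_split split del: if_split)
      moreover have "k p' \<triangleright> q' \<in> stacks"
        using pq' by (auto intro: closed)
      ultimately show ?thesis
        using h(2) by blast
    qed
    then have "descent \<star> u \<triangleright> v \<triangleright> h \<triangleright> k p \<triangleright> q"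
      using u v pq h(1) uv unfolding forces_progressive_iff
      by (intro run_descent[where P = ?P and Q = ?Q]) blast+
    then show ?thesis
      unfolding pq(2) by - (rule execution terms_closed uv h(1) pq(3,4) | assumption)+
  qed
  then show ?thesis
    unfolding forces_progressive_iff by (intro conjI terms_closed uv) blast
qed

text \<open>Against the refutations \<open>a\<close> and \<open>b\<close>, a point \<open>x\<close>
  of \<open>X\<close> is held fixed while \<open>b\<close> is run to obtain a point \<open>y\<close>
  of \<open>Y\<close>; then \<open>f\<close> is applied to the merged set.\<close>

lemma forces_splitter:
  assumes "\<alpha> \<in> {zero E, one E}" "\<beta> \<in> {zero E, one E}"
  shows "forces E A splitter (WF E (bjoin E \<alpha> \<beta>) \<^bold>\<rightarrow> WF E \<alpha> \<^bold>\<or> WF E \<beta>)"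
proof -
  have "splitter \<star> f \<triangleright> a \<triangleright> b \<triangleright> r"
    if f: "forces E A f (WF E (bjoin E \<alpha> \<beta>))" and a: "forces E A a (\<^bold>\<not> WF E \<alpha>)"
      and b: "forces E A b (\<^bold>\<not> WF E \<beta>)" and r: "r \<in> stacks" for f a b r
  proof -
    have fab: "f \<in> terms" "a \<in> terms" "b \<in> terms"
      using f a b by (auto simp: forces_def)
    have "split_left \<cdot> f \<cdot> b \<star> u \<triangleright> p"
      if u: "forces E A u (progressive \<alpha> X)" and p: "p \<in> stacks" "opair E x p \<in> ext E X"
      for X u x p
    proof -
      have ut: "u \<in> terms"
        using u by (simp add: forces_def)
      have "split_body \<cdot> f \<cdot> u \<cdot> k p \<star> v \<triangleright> q"
        if v: "forces E A v (progressive \<beta> Y)" and q: "q \<in> stacks" "opair E y q \<in> ext E Y"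
        for Y v y q
      proof -
        have vt: "v \<in> terms"
          using v by (simp add: forces_def)
        obtain Z where Z: "merges (\<alpha> = one E) X Y Z"
          using merges_ex by blast
        have st: "k p \<triangleright> q \<in> stacks"
          by (intro closed p(1) q(1))
        have "opair E (if \<alpha> = one E then x else y) (k p \<triangleright> q) \<in> ext E Z"
          by (intro mergesI[OF Z] p q)
        with descent_progressive[OF assms Z u v] f st
        have "f \<star> (descent \<cdot> u \<cdot> v) \<triangleright> k p \<triangleright> q"
          unfolding forces_WF_iff by blast
        then show ?thesis
          by - (rule execution run_split_body terms_closed fab ut vt p(1) q(1) | assumption)+
      qed
      then have "forces E A (split_body \<cdot> f \<cdot> u \<cdot> k p) (WF E \<beta>)"
        unfolding forces_WF_iff by (intro conjI terms_closed fab ut p(1)) blast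
      \<comment> \<open>The refutation \<open>b\<close> accepts any stack, so it can run on the very
        \<open>p\<close> that \<open>cc\<close> saved as \<open>k p\<close>.\<close>
      then have "b \<star> (split_body \<cdot> f \<cdot> u \<cdot> k p) \<triangleright> p"
        using b p(1) by (simp add: Not_zfe_def forces_Imp_iff)
      then show ?thesis
        by - (rule execution run_split_left terms_closed fab ut p(1) | assumption)+
    qed
    then have "forces E A (split_left \<cdot> f \<cdot> b) (WF E \<alpha>)"
      unfolding forces_WF_iff by (intro conjI terms_closed fab) blast
    then have "a \<star> (split_left \<cdot> f \<cdot> b) \<triangleright> r"
      using a r by (simp add: Not_zfe_def forces_Imp_iff)
    then show ?thesis
      by - (rule run_splitter fab r | assumption)+
  qed
  then show ?thesis
    using combinators_QP(6)[THEN QP_terms]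
    unfolding forces_Imp_iff Or_zfe_def by (auto simp: forces_def)
qed

end

theorem theorem15:
  fixes E :: "'m \<Rightarrow> 'm \<Rightarrow> bool" and A :: "'m ralg"
  assumes "ZF_model E" and "V_eq_L E" and "realizability_algebra E A"
  shows "realized E A
           (\<forall>\<^bold>2\<alpha>. \<forall>\<^bold>2\<beta>. (bmeet E \<alpha> \<beta> = zero E) \<hookrightarrow>
              (WF E (bjoin E \<alpha> \<beta>) \<^bold>\<rightarrow> WF E \<alpha> \<^bold>\<or> WF E \<beta>)) \<and>
         realized E A
           (\<forall>\<^bold>2\<alpha>. \<forall>\<^bold>2\<beta>. WF E (bjoin E \<alpha> \<beta>) \<^bold>\<rightarrow> WF E \<alpha> \<^bold>\<or> WF E \<beta>)"
proof -
  interpret krivine_model E A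
    using assms by unfold_locales
  have "forces E A splitter
      (\<forall>\<^bold>2\<alpha>. \<forall>\<^bold>2\<beta>. WF E (bjoin E \<alpha> \<beta>) \<^bold>\<rightarrow> WF E \<alpha> \<^bold>\<or> WF E \<beta>)"
    unfolding forces_ForallB2_iff by (intro ballI forces_splitter)
  moreover have "forces E A splitter (\<forall>\<^bold>2\<alpha>. \<forall>\<^bold>2\<beta>. (bmeet E \<alpha> \<beta> = zero E) \<hookrightarrow>
      (WF E (bjoin E \<alpha> \<beta>) \<^bold>\<rightarrow> WF E \<alpha> \<^bold>\<or> WF E \<beta>))"
    unfolding forces_ForallB2_iff
    by (intro ballI forces_Guard forces_splitter)
  ultimately show ?thesis
    using combinators_QP(6) unfolding realized_def by blast
qed

end
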